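(* Let $L=a_{11}X_1^2+2a_{12}X_2X_1+a_{22}X_2^2$ be an operator with ellipticity constants $\lambda,\Lambda$, and let $0<\gamma<1$. Suppose that for every $y\in\mathbb{R}^2$ and $r>0$ there exists a $\gamma$-lower barrier function $\Phi$ for the ring $R(y,r,3r)=\tilde G(y,3r)\setminus\overline{\tilde G(y,r)}$ and for the operator $L$. Then the Double Ball Property holds in $\tilde G(y,3r)$ with constant $\gamma$: for every $y\in\mathbb{R}^2$ and $r>0$, if $u\in C^2(\tilde G(y,3r))\cap C(\overline{\tilde G(y,3r)})$ satisfies $u\ge 0$ and $Lu\le 0$ in $\tilde G(y,3r)$ and $u\ge 1$ on $\tilde G(y,r)$, then $u\ge\gamma$ in $\tilde G(y,2r)$.
   Context: On $\mathbb{R}^2$ with points $x=(x_1,x_2)$, let $X_1=\partial_{x_1}$ and $X_2=x_1\partial_{x_2}$ (Grushin vector fields). The operator is $L=a_{11}X_1^2+2a_{12}X_2X_1+a_{22}X_2^2$, i.e. $Lu=a_{11}u_{x_1x_1}+2a_{12}X_2X_1u+a_{22}X_2^2u$ with $X_2X_1u=x_1u_{x_1x_2}$ and $X_2^2u=x_1^2u_{x_2x_2}$, where $a_{11},a_{12},a_{22}$ are measurable real functions on $\mathbb{R}^2$ such that at every point $\lambda(\xi_1^2+\xi_2^2)\le a_{11}\xi_1^2+2a_{12}\xi_1\xi_2+a_{22}\xi_2^2\le\Lambda(\xi_1^2+\xi_2^2)$ for all $\xi\in\mathbb{R}^2$, with $0<\lambda\le\Lambda$; then $\lambda,\Lambda$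 are called ellipticity constants of $L$. Let $\rho(x,y)=\left((x_1^2-y_1^2)^2+4(x_2-y_2)^2\right)^{1/4}$. For $r>0$ define $\tilde g_r(x,y)=\rho(x,y)$ if $|y_1|<r$ and $\tilde g_r(x,y)=\rho^2(x,y)/|y_1|$ if $|y_1|\ge r$, and set $\tilde G(y,r)=\{x\in\mathbb{R}^2:\tilde g_r(x,y)<r\}$. For $0<\gamma<1$, a function $\Phi$ is a $\gamma$-lower barrier function for the ring $R(y,r,3r)=\tilde G(y,3r)\setminus\overline{\tilde G(y,r)}$ and for $L$ if: $\Phi\in C^2(R(y,r,3r))\cap C(\overline{R(y,r,3r)})$; $L\Phi\ge 0$ on $R(y,r,3r)$; $\Phi\le 0$ on $\partial\tilde G(y,3r)$; $\Phi\le 1$ on $\partial\tilde G(y,r)$; and $\inf_{\partial\tilde G(y,2r)}\Phi\ge\gamma$. ($\Phi$ may depend on $y$ and $r$, but $\gamma$ does not.) *)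

theory Defs
  imports "HOL-Analysis.Analysis"
begin

definition partial :: "2 \<Rightarrow> (real^2 \<Rightarrow> real) \<Rightarrow> real^2 \<Rightarrow> real" where
  "partial i u x = frechet_derivative u (at x) (axis i 1)"

text \<open>The next two predicates are meant for open sets \<open>S\<close>.\<close>

definition C1_on :: "(real^2) set \<Rightarrow> (real^2 \<Rightarrow> real) \<Rightarrow> bool" where
  "C1_on S u \<longleftrightarrow>
     (\<forall>x\<in>S. u differentiable (at x)) \<and> (\<forall>i. continuous_on S (partial i u))"

definition C2_on :: "(real^2) set \<Rightarrow> (real^2 \<Rightarrow> real) \<Rightarrow> bool" where
  "C2_on S u \<longleftrightarrow> C1_on S u \<and> (\<forall>i. C1_on S (partial i u))"

definition X1 :: "(real^2 \<Rightarrow> real) \<Rightarrow> real^2 \<Rightarrow> real" where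
  "X1 u x = partial 1 u x"

definition X2 :: "(real^2 \<Rightarrow> real) \<Rightarrow> real^2 \<Rightarrow> real" where
  "X2 u x = x$1 * partial 2 u x"

definition grushin_op ::
  "(real^2 \<Rightarrow> real) \<Rightarrow> (real^2 \<Rightarrow> real) \<Rightarrow> (real^2 \<Rightarrow> real) \<Rightarrow>
   (real^2 \<Rightarrow> real) \<Rightarrow> real^2 \<Rightarrow> real" where
  "grushin_op a11 a12 a22 u x =
     a11 x * X1 (X1 u) x + 2 * a12 x * X2 (X1 u) x + a22 x * X2 (X2 u) x"

definition ellipticity_constants ::
  "(real^2 \<Rightarrow> real) \<Rightarrow> (real^2 \<Rightarrow> real) \<Rightarrow> (real^2 \<Rightarrow> real) \<Rightarrow> real \<Rightarrow> real \<Rightarrow> bool" where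
  "ellipticity_constants a11 a12 a22 lam Lam \<longleftrightarrow>
     0 < lam \<and> lam \<le> Lam \<and>
     (\<forall>x. \<forall>\<xi> :: real^2.
        lam * ((\<xi>$1)\<^sup>2 + (\<xi>$2)\<^sup>2)
          \<le> a11 x * (\<xi>$1)\<^sup>2 + 2 * a12 x * \<xi>$1 * \<xi>$2 + a22 x * (\<xi>$2)\<^sup>2 \<and>
        a11 x * (\<xi>$1)\<^sup>2 + 2 * a12 x * \<xi>$1 * \<xi>$2 + a22 x * (\<xi>$2)\<^sup>2
          \<le> Lam * ((\<xi>$1)\<^sup>2 + (\<xi>$2)\<^sup>2))"

definition rho :: "real^2 \<Rightarrow> real^2 \<Rightarrow> real" where
  "rho x y = root 4 (((x$1)\<^sup>2 - (y$1)\<^sup>2)\<^sup>2 + 4 * (x$2 - y$2)\<^sup>2)"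

definition g_tilde :: "real \<Rightarrow> real^2 \<Rightarrow> real^2 \<Rightarrow> real" where
  "g_tilde r x y = (if \<bar>y$1\<bar> < r then rho x y else (rho x y)\<^sup>2 / \<bar>y$1\<bar>)"

definition G_tilde :: "real^2 \<Rightarrow> real \<Rightarrow> (real^2) set" where
  "G_tilde y r = {x. g_tilde r x y < r}"

text \<open>The ring \<open>R(y, r, 3r)\<close>.\<close>

definition ring3 :: "real^2 \<Rightarrow> real \<Rightarrow> (real^2) set" where
  "ring3 y r = G_tilde y (3 * r) - closure (G_tilde y r)"

definition lower_barrier ::
  "((real^2 \<Rightarrow> real) \<Rightarrow> real^2 \<Rightarrow> real) \<Rightarrow> real \<Rightarrow> real^2 \<Rightarrow> real \<Rightarrow> (real^2 \<Rightarrow> real) \<Rightarrow> bool" where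
  "lower_barrier L \<gamma> y r \<Phi> \<longleftrightarrow>
     C2_on (ring3 y r) \<Phi> \<and> continuous_on (closure (ring3 y r)) \<Phi> \<and>
     (\<forall>x\<in>ring3 y r. L \<Phi> x \<ge> 0) \<and>
     (\<forall>x\<in>frontier (G_tilde y (3 * r)). \<Phi> x \<le> 0) \<and>
     (\<forall>x\<in>frontier (G_tilde y r). \<Phi> x \<le> 1) \<and>
     (INF x\<in>frontier (G_tilde y (2 * r)). \<Phi> x) \<ge> \<gamma>"

definition double_ball_property ::
  "((real^2 \<Rightarrow> real) \<Rightarrow> real^2 \<Rightarrow> real) \<Rightarrow> real \<Rightarrow> bool" where
  "double_ball_property L \<gamma> \<longleftrightarrow>
     (\<forall>y r u. r > 0 \<longrightarrow>
        C2_on (G_tilde y (3 * r)) u \<longrightarrow>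
        continuous_on (closure (G_tilde y (3 * r))) u \<longrightarrow>
        (\<forall>x\<in>G_tilde y (3 * r). u x \<ge> 0) \<longrightarrow>
        (\<forall>x\<in>G_tilde y (3 * r). L u x \<le> 0) \<longrightarrow>
        (\<forall>x\<in>G_tilde y r. u x \<ge> 1) \<longrightarrow>
        (\<forall>x\<in>G_tilde y (2 * r). u x \<ge> \<gamma>))"

end

theory Submission
  imports Defs
begin

text \<open>
  A weak maximum principle holds for \<open>L\<close> on bounded open sets although \<open>L\<close> degenerates on
  \<open>x\<^sub>1 = 0\<close>: since \<open>L (x\<^sub>1\<^sup>2) = 2 a\<^sub>1\<^sub>1 > 0\<close> everywhere, a small multiple of \<open>x\<^sub>1\<^sup>2\<close> makes a
  subsolution strict, which is impossible at an interior maximum. Each \<open>G_tilde y r\<close> is a sublevel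
  set of one fixed polynomial, at a level strictly increasing in \<open>r\<close>, so the boundary of the middle
  ball lies inside the ring. Comparing the barrier with \<open>u\<close> in the ring gives \<open>u \<ge> \<gamma>\<close> on that
  boundary, and comparing \<open>u\<close> with the constant \<open>\<gamma>\<close> propagates this to the inside.
\<close>

section \<open>Partial derivatives\<close>

lemma partial_eqI: "(f has_derivative f') (at x) \<Longrightarrow> partial i f x = f' (axis i 1)"
  unfolding partial_def by (metis frechet_derivative_at)

lemma partial_cong:
  assumes "open S" "x \<in> S" "\<And>y. y \<in> S \<Longrightarrow> f y = g y"
  shows "partial i f x = partial i g x"
proof -
  \<comment> \<open>\<open>frechet_derivative\<close> is chosen from the set of all derivatives at
    \<open>x\<close>. Since \<open>f\<close> and \<open>g\<close> have the same such set, the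
    choices agree even where no derivative exists.\<close>
  have "(f has_derivative f') (at x) \<longleftrightarrow> (g has_derivative f') (at x)" for f'
    using assms has_derivative_transform_within_open[of f f' x UNIV S g]
      has_derivative_transform_within_open[of g f' x UNIV S f] by auto
  then show ?thesis unfolding partial_def frechet_derivative_def by simp
qed

lemma has_derivative_partial:
  assumes "f differentiable (at x)"
  shows "(f has_derivative (\<lambda>h. partial 1 f x * h$1 + partial 2 f x * h$2)) (at x)"
proof -
  let ?D = "frechet_derivative f (at x)"
  have D: "(f has_derivative ?D) (at x)" using assms by (simp add: frechet_derivative_works)
  interpret linear ?D using D has_derivative_linear by blast
  have "?D h = partial 1 f x * h$1 + partial 2 f x * h$2" for h
  proof -
    have "h = h$1 *\<^sub>R axis 1 1 + h$2 *\<^sub>R axis 2 1"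
      by (simp add: vec_eq_iff forall_2 axis_def)
    then have "?D h = ?D (h$1 *\<^sub>R axis 1 1 + h$2 *\<^sub>R axis 2 1)" by simp
    then show ?thesis by (simp add: add scale partial_def)
  qed
  then have "?D = (\<lambda>h. partial 1 f x * h$1 + partial 2 f x * h$2)" by auto
  with D show ?thesis by simp
qed

lemma has_real_derivative_line:
  assumes "f differentiable (at (x + t *\<^sub>R h))"
  shows "((\<lambda>t. f (x + t *\<^sub>R h)) has_real_derivative
     partial 1 f (x + t *\<^sub>R h) * h$1 + partial 2 f (x + t *\<^sub>R h) * h$2) (at t)"
proof -
  have "((\<lambda>t. x + t *\<^sub>R h) has_derivative (\<lambda>s. s *\<^sub>R h)) (at t)"
    by (rule has_derivative_eq_rhs[OF has_derivative_add[OF has_derivative_const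
          has_derivative_scaleR_left[OF has_derivative_ident]]]) simp
  from has_derivative_compose[OF this has_derivative_partial[OF assms]]
  show ?thesis unfolding has_field_derivative_def
    by (rule has_derivative_eq_rhs) (simp add: fun_eq_iff algebra_simps)
qed

lemma has_real_derivative_axis:
  assumes "f differentiable (at (x + t *\<^sub>R axis i 1))"
  shows "((\<lambda>t. f (x + t *\<^sub>R axis i 1)) has_real_derivative partial i f (x + t *\<^sub>R axis i 1)) (at t)"
  using has_real_derivative_line[OF assms] exhaust_2[of i] by (auto simp: axis_def)

lemma C2_onD:
  assumes "C2_on S f" "x \<in> S"
  shows "f differentiable (at x)" "partial i f differentiable (at x)"
  using assms unfolding C2_on_def C1_on_def by auto

lemma C2_on_subset: "C2_on S f \<Longrightarrow> T \<subseteq> S \<Longrightarrow> C2_on T f"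
  unfolding C2_on_def C1_on_def by (meson continuous_on_subset subsetD)

text \<open>Two mean value steps: the second difference is an increment in direction
  \<open>i\<close> of a difference in direction \<open>j\<close>, and each step contributes one
  factor \<open>t\<close> and one partial derivative.\<close>

lemma second_difference_mean_value:
  assumes f: "C2_on (ball x e) f" and t: "0 < t" "2 * t < e"
  shows "\<exists>p\<in>ball x (2 * t).
    f (x + t *\<^sub>R axis i 1 + t *\<^sub>R axis j 1) - f (x + t *\<^sub>R axis i 1) - f (x + t *\<^sub>R axis j 1) + f x
      = t\<^sup>2 * partial j (partial i f) p"
proof -
  define a :: "real^2" where "a = axis i 1"
  define b :: "real^2" where "b = axis j 1"
  have nrm: "norm a = 1" "norm b = 1" by (auto simp: a_def b_def)
  have near: "dist x (x + s *\<^sub>R a + r *\<^sub>R b) \<le> \<bar>s\<bar> + \<bar>r\<bar>" for s r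
  proof -
    have "dist x (x + s *\<^sub>R a + r *\<^sub>R b) = norm (s *\<^sub>R a + r *\<^sub>R b)"
      by (subst dist_commute) (simp add: dist_norm add.assoc)
    also have "\<dots> \<le> norm (s *\<^sub>R a) + norm (r *\<^sub>R b)" by (rule norm_triangle_ineq)
    finally show ?thesis by (simp add: nrm)
  qed
  have inball: "x + s *\<^sub>R a + r *\<^sub>R b \<in> ball x e" if "0 \<le> s" "s \<le> t" "0 \<le> r" "r \<le> t" for s r
    using near[of s r] that t by simp
  have eq: "x + t *\<^sub>R b + s *\<^sub>R a = x + s *\<^sub>R a + t *\<^sub>R b" for s by simp
  \<comment> \<open>Its increment from 0 to \<open>t\<close> is the second difference.\<close>
  define g where "g s = f (x + t *\<^sub>R b + s *\<^sub>R a) - f (x + s *\<^sub>R a)" for s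
  have "\<exists>s>0. s < t \<and> g t - g 0
      = (t - 0) * (partial i f (x + t *\<^sub>R b + s *\<^sub>R a) - partial i f (x + s *\<^sub>R a))"
  proof (rule MVT2[OF t(1)])
    fix s assume s: "0 \<le> s" "s \<le> t"
    have "x + t *\<^sub>R b + s *\<^sub>R a \<in> ball x e" "x + s *\<^sub>R a \<in> ball x e"
      unfolding eq using inball[OF s, of t] inball[OF s, of 0] t by simp_all
    then have "f differentiable (at (x + t *\<^sub>R b + s *\<^sub>R a))" "f differentiable (at (x + s *\<^sub>R a))"
      using C2_onD(1)[OF f] by auto
    then show "(g has_real_derivative
        partial i f (x + t *\<^sub>R b + s *\<^sub>R a) - partial i f (x + s *\<^sub>R a)) (at s)"
      unfolding g_def a_def by (intro DERIV_diff has_real_derivative_axis) auto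
  qed
  then obtain s where s: "0 < s" "s < t" and
    gs: "g t - g 0 = t * (partial i f (x + t *\<^sub>R b + s *\<^sub>R a) - partial i f (x + s *\<^sub>R a))"
    by auto
  have "\<exists>r>0. r < t \<and> partial i f (x + s *\<^sub>R a + t *\<^sub>R b) - partial i f (x + s *\<^sub>R a + 0 *\<^sub>R b)
      = (t - 0) * partial j (partial i f) (x + s *\<^sub>R a + r *\<^sub>R b)"
  proof (rule MVT2[OF t(1)])
    fix r assume r: "0 \<le> r" "r \<le> t"
    have "x + s *\<^sub>R a + r *\<^sub>R b \<in> ball x e" using inball[of s r] s r by auto
    then show "((\<lambda>r. partial i f (x + s *\<^sub>R a + r *\<^sub>R b)) has_real_derivative
        partial j (partial i f) (x + s *\<^sub>R a + r *\<^sub>R b)) (at r)"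
      unfolding b_def by (intro has_real_derivative_axis C2_onD(2)[OF f])
  qed
  then obtain r where r: "0 < r" "r < t" and
    gr: "partial i f (x + s *\<^sub>R a + t *\<^sub>R b) - partial i f (x + s *\<^sub>R a)
      = t * partial j (partial i f) (x + s *\<^sub>R a + r *\<^sub>R b)"
    by auto
  have "g t - g 0 = t\<^sup>2 * partial j (partial i f) (x + s *\<^sub>R a + r *\<^sub>R b)"
    using gs gr by (simp add: eq power2_eq_square)
  moreover have "g t - g 0 = f (x + t *\<^sub>R a + t *\<^sub>R b) - f (x + t *\<^sub>R a) - f (x + t *\<^sub>R b) + f x"
    by (simp add: g_def eq)
  moreover have "x + s *\<^sub>R a + r *\<^sub>R b \<in> ball x (2 * t)" using near[of s r] s r by simp
  ultimately show ?thesis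
    unfolding a_def[symmetric] b_def[symmetric]
    by (intro bexI[of _ "x + s *\<^sub>R a + r *\<^sub>R b"]) simp_all
qed

text \<open>The second difference is symmetric in \<open>i\<close> and \<open>j\<close>, so both
  mixed partials take a common value at points arbitrarily near \<open>x\<close>; continuity forces
  equality at \<open>x\<close>. \<open>C2_on\<close> does not include this symmetry.\<close>

lemma mixed_partials_commute:
  assumes S: "open S" "x \<in> S" and f: "C2_on S f"
  shows "partial j (partial i f) x = partial i (partial j f) x"
proof (rule ccontr)
  let ?P = "partial j (partial i f)" and ?Q = "partial i (partial j f)"
  assume "?P x \<noteq> ?Q x"
  \<comment> \<open>Half the supposed gap: two errors below \<open>\<epsilon>\<close> cannot add up
    to it.\<close>
  define \<epsilon> where "\<epsilon> = \<bar>?P x - ?Q x\<bar> / 2"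
  have \<epsilon>: "\<epsilon> > 0" using \<open>?P x \<noteq> ?Q x\<close> by (simp add: \<epsilon>_def)
  have "isCont ?P x" "isCont ?Q x"
    using f S continuous_on_eq_continuous_at unfolding C2_on_def C1_on_def by blast+
  then obtain d1 d2 where d: "d1 > 0" "d2 > 0"
    and P: "\<And>p. dist p x < d1 \<Longrightarrow> dist (?P p) (?P x) < \<epsilon>"
    and Q: "\<And>p. dist p x < d2 \<Longrightarrow> dist (?Q p) (?Q x) < \<epsilon>"
    using \<epsilon> unfolding continuous_at_eps_delta by metis
  obtain e where e: "e > 0" "ball x e \<subseteq> S" using S openE by blast
  \<comment> \<open>The mean value points lie within \<open>2 * t\<close> of \<open>x\<close>, so a
    third of the smallest radius suffices.\<close>
  define t where "t = min e (min d1 d2) / 3"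
  have t: "0 < t" "2 * t < e" "2 * t < d1" "2 * t < d2" using d e by (auto simp: t_def min_def)
  have fe: "C2_on (ball x e) f" using f e C2_on_subset by blast
  obtain p where p: "p \<in> ball x (2 * t)"
    "f (x + t *\<^sub>R axis i 1 + t *\<^sub>R axis j 1) - f (x + t *\<^sub>R axis i 1) - f (x + t *\<^sub>R axis j 1) + f x
      = t\<^sup>2 * ?P p" using second_difference_mean_value[OF fe t(1,2)] by blast
  obtain q where q: "q \<in> ball x (2 * t)"
    "f (x + t *\<^sub>R axis j 1 + t *\<^sub>R axis i 1) - f (x + t *\<^sub>R axis j 1) - f (x + t *\<^sub>R axis i 1) + f x
      = t\<^sup>2 * ?Q q" using second_difference_mean_value[OF fe t(1,2)] by blast
  have "x + t *\<^sub>R axis j 1 + t *\<^sub>R axis i 1 = x + t *\<^sub>R axis i 1 + t *\<^sub>R axis j 1" by simp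
  from q(2)[unfolded this] p(2) have "t\<^sup>2 * ?P p = t\<^sup>2 * ?Q q" by linarith
  then have eq: "?P p = ?Q q" using t by simp
  have "dist (?P p) (?P x) < \<epsilon>" "dist (?Q q) (?Q x) < \<epsilon>"
    using P[of p] Q[of q] p(1) q(1) t by (auto simp: dist_commute)
  then have "dist (?P x) (?Q x) < \<epsilon> + \<epsilon>"
    using dist_triangle3[of "?P x" "?Q x" "?P p"] unfolding eq by linarith
  then show False by (simp add: \<epsilon>_def dist_real_def)
qed

text \<open>Restricting \<open>f\<close> to the line through \<open>x\<close> in direction
  \<open>(a, b)\<close> reduces the claim to one variable: a positive second derivative would
  contradict the maximum.\<close>

lemma second_partials_nonpos_at_max:
  assumes S: "open S" "x \<in> S" and f: "C2_on S f" and max: "\<And>y. y \<in> S \<Longrightarrow> f y \<le> f x"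
  shows "partial 1 (partial 1 f) x * a\<^sup>2 + 2 * partial 2 (partial 1 f) x * a * b
    + partial 2 (partial 2 f) x * b\<^sup>2 \<le> 0"
proof (rule ccontr)
  assume pos: "\<not> ?thesis"
  define h :: "real^2" where "h = vector [a, b]"
  have h: "h$1 = a" "h$2 = b" by (auto simp: h_def)
  have "open ((\<lambda>t. x + t *\<^sub>R h) -` S)"
    by (intro continuous_open_vimage S continuous_intros)
  moreover have "(0::real) \<in> (\<lambda>t. x + t *\<^sub>R h) -` S" using S by simp
  ultimately obtain e where e: "e > 0" and "ball 0 e \<subseteq> (\<lambda>t. x + t *\<^sub>R h) -` S"
    by (meson openE)
  then have inS: "x + t *\<^sub>R h \<in> S" if "\<bar>t\<bar> < e" for t using that by auto
  define \<phi> where "\<phi> t = f (x + t *\<^sub>R h)" for t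
  define \<phi>' where "\<phi>' t = partial 1 f (x + t *\<^sub>R h) * a + partial 2 f (x + t *\<^sub>R h) * b" for t
  have d1: "(\<phi> has_real_derivative \<phi>' t) (at t)" if "\<bar>t\<bar> < e" for t
    using has_real_derivative_line[OF C2_onD(1)[OF f inS[OF that]]]
    unfolding \<phi>_def \<phi>'_def by (simp add: h)
  have d2: "(\<phi>' has_real_derivative
      (partial 1 (partial 1 f) x * a + partial 2 (partial 1 f) x * b) * a
      + (partial 1 (partial 2 f) x * a + partial 2 (partial 2 f) x * b) * b) (at 0)"
    unfolding \<phi>'_def
    using has_real_derivative_line[of "partial 1 f" x 0 h]
      has_real_derivative_line[of "partial 2 f" x 0 h] C2_onD(2)[OF f S(2)]
    by (auto intro!: DERIV_add DERIV_cmult_right simp: h)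
  have "\<phi>' 0 = 0"
    using DERIV_local_max[OF d1[of 0] e] max inS e by (simp add: \<phi>_def)
  have "0 < (partial 1 (partial 1 f) x * a + partial 2 (partial 1 f) x * b) * a
      + (partial 1 (partial 2 f) x * a + partial 2 (partial 2 f) x * b) * b"
    \<comment> \<open>The chain rule produces both mixed partials; symmetry merges them into the
      term with factor 2.\<close>
    using pos mixed_partials_commute[OF S f, of 1 2]
    by (simp add: power2_eq_square algebra_simps)
  \<comment> \<open>As \<open>\<phi>'\<close> vanishes at 0 with positive slope, it is positive just
    to the right, so \<open>\<phi>\<close> rises above its maximum by the mean value
    theorem.\<close>
  from DERIV_pos_inc_right[OF d2 this] \<open>\<phi>' 0 = 0\<close>
  obtain d where d: "d > 0" "\<And>t. 0 < t \<Longrightarrow> t < d \<Longrightarrow> 0 < \<phi>' t" by auto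
  define t where "t = min d e / 2"
  have t: "0 < t" "t < d" "t < e" using d e by (auto simp: t_def min_def)
  have "\<exists>s>0. s < t \<and> \<phi> t - \<phi> 0 = (t - 0) * \<phi>' s"
    by (rule MVT2[OF t(1)]) (use d1 t in auto)
  then obtain s where s: "0 < s" "s < t" "\<phi> t - \<phi> 0 = t * \<phi>' s" by auto
  moreover have "t * \<phi>' s > 0" using d(2)[of s] s t by simp
  ultimately have "\<phi> t > \<phi> 0" by linarith
  then show False using max[OF inS[of t]] t by (simp add: \<phi>_def)
qed

section \<open>Differences, constants and multiples of the squared first coordinate as functions of
  class C^2\<close>

lemma partial_diff:
  assumes "f differentiable (at x)" "g differentiable (at x)"
  shows "partial i (\<lambda>x. f x - g x) x = partial i f x - partial i g x"
  using partial_eqI[OF has_derivative_diff[OF has_derivative_partial[OF assms(1)]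
        has_derivative_partial[OF assms(2)]], of i] exhaust_2[of i]
  by (auto simp: axis_def)

text \<open>The rule for partials of a difference holds only on \<open>S\<close>, so regularity of
  second order must pass between functions that agree on \<open>S\<close> alone.\<close>

lemma C1_on_cong:
  assumes "open S" "\<And>y. y \<in> S \<Longrightarrow> f y = g y" "C1_on S f"
  shows "C1_on S g"
proof -
  have "g differentiable (at x)" if x: "x \<in> S" for x
  proof -
    obtain f' where "(f has_derivative f') (at x)"
      using assms(3) x unfolding C1_on_def differentiable_def by blast
    from has_derivative_transform_within_open[OF this assms(1) x assms(2)]
    show ?thesis by (rule differentiableI)
  qed
  moreover have "continuous_on S (partial i g)" for i
  proof (rule continuous_on_eq)
    show "continuous_on S (partial i f)" using assms(3) unfolding C1_on_def by blast
    show "partial i f x = partial i g x" if "x \<in> S" for x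
      using assms(1) that assms(2) by (rule partial_cong)
  qed
  ultimately show ?thesis unfolding C1_on_def by blast
qed

lemma C1_on_diff:
  assumes "open S" "C1_on S f" "C1_on S g"
  shows "C1_on S (\<lambda>x. f x - g x)"
proof -
  have "continuous_on S (partial i (\<lambda>x. f x - g x))" for i
  proof -
    have "continuous_on S (\<lambda>x. partial i f x - partial i g x)"
      using assms unfolding C1_on_def by (intro continuous_on_diff) auto
    then show ?thesis
      by (rule continuous_on_eq) (use assms in \<open>auto simp: partial_diff C1_on_def\<close>)
  qed
  then show ?thesis using assms unfolding C1_on_def by (auto intro: differentiable_diff)
qed

lemma C2_on_diff:
  assumes "open S" "C2_on S f" "C2_on S g"
  shows "C2_on S (\<lambda>x. f x - g x)"
proof -
  have "C1_on S (partial i (\<lambda>x. f x - g x))" for i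
  proof (rule C1_on_cong[OF assms(1)])
    show "C1_on S (\<lambda>x. partial i f x - partial i g x)"
      using assms C1_on_diff unfolding C2_on_def by blast
  qed (use assms in \<open>auto simp: partial_diff C2_onD\<close>)
  then show ?thesis using assms C1_on_diff unfolding C2_on_def by blast
qed

lemma partial_const: "partial i (\<lambda>x. c) = (\<lambda>x. 0)"
  by (rule ext, rule partial_eqI[OF has_derivative_const, THEN trans]) simp

lemma C2_on_const: "C2_on S (\<lambda>x. c)"
  unfolding C2_on_def C1_on_def by (simp add: partial_const)

lemma partial_square_fst:
  "partial i (\<lambda>x. c * (x$1)\<^sup>2) = (\<lambda>x. if i = 1 then 2 * c * x$1 else 0)"
proof
  fix x :: "real^2"
  have "((\<lambda>x. c * (x$1)\<^sup>2) has_derivative (\<lambda>h. 2 * c * x$1 * h$1)) (at x)"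
    by (auto intro!: derivative_eq_intros bounded_linear_imp_has_derivative
        bounded_linear_vec_nth simp: algebra_simps)
  from partial_eqI[OF this, of i] exhaust_2[of i]
  show "partial i (\<lambda>x. c * (x$1)\<^sup>2) x = (if i = 1 then 2 * c * x$1 else 0)"
    by (auto simp: axis_def)
qed

lemma partial_scaled_fst: "partial i (\<lambda>x. c * x$1) = (\<lambda>x. if i = 1 then c else 0)"
proof
  fix x :: "real^2"
  have "((\<lambda>x. c * x$1) has_derivative (\<lambda>h. c * h$1)) (at x)"
    by (intro has_derivative_mult_right bounded_linear_imp_has_derivative bounded_linear_vec_nth)
  from partial_eqI[OF this, of i] exhaust_2[of i]
  show "partial i (\<lambda>x. c * x$1) x = (if i = 1 then c else 0)"
    by (auto simp: axis_def)
qed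

lemma C2_on_square_fst: "C2_on S (\<lambda>x. c * (x$1)\<^sup>2)"
proof -
  have d: "(\<lambda>x::real^2. x$1) differentiable (at x)" for x
    by (intro linear_imp_differentiable bounded_linear.linear bounded_linear_vec_nth)
  have "C1_on S (\<lambda>x::real^2. c * (x$1)\<^sup>2)"
  proof -
    have "continuous_on S (partial i (\<lambda>x::real^2. c * (x$1)\<^sup>2))" for i
      unfolding partial_square_fst by (cases "i = 1") (auto intro!: continuous_intros)
    then show ?thesis unfolding C1_on_def by (auto intro!: d differentiable_mult differentiable_power)
  qed
  moreover have "C1_on S (partial i (\<lambda>x::real^2. c * (x$1)\<^sup>2))" for i
    unfolding C1_on_def partial_square_fst
    by (cases "i = 1")
      (auto simp: partial_scaled_fst partial_const intro!: d differentiable_mult)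
  ultimately show ?thesis unfolding C2_on_def by blast
qed

section \<open>The weak maximum principle\<close>

text \<open>The coefficient \<open>x$1\<close> of \<open>X2\<close> does not vary in direction 2, so
  expanding \<open>X2 (X2 f)\<close> leaves no first-order term.\<close>

lemma grushin_op_eq:
  assumes S: "open S" "x \<in> S" and f: "C2_on S f"
  shows "grushin_op a11 a12 a22 f x = a11 x * partial 1 (partial 1 f) x
    + 2 * a12 x * (x$1 * partial 2 (partial 1 f) x) + a22 x * ((x$1)\<^sup>2 * partial 2 (partial 2 f) x)"
proof -
  have 1: "X1 f = partial 1 f" by (auto simp: X1_def)
  have "((\<lambda>x. x$1 * partial 2 f x) has_derivative
      (\<lambda>h. x$1 * (partial 1 (partial 2 f) x * h$1 + partial 2 (partial 2 f) x * h$2)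
        + h$1 * partial 2 f x)) (at x)"
    by (intro has_derivative_mult bounded_linear_imp_has_derivative bounded_linear_vec_nth
        has_derivative_partial C2_onD(2)[OF f S(2)])
  from partial_eqI[OF this, of 2] have "partial 2 (X2 f) x = x$1 * partial 2 (partial 2 f) x"
    by (simp add: X2_def[abs_def] axis_def)
  then show ?thesis
    unfolding grushin_op_def 1 by (simp add: X1_def X2_def power2_eq_square)
qed

lemma grushin_op_diff:
  assumes S: "open S" "x \<in> S" and f: "C2_on S f" and g: "C2_on S g"
  shows "grushin_op a11 a12 a22 (\<lambda>x. f x - g x) x
    = grushin_op a11 a12 a22 f x - grushin_op a11 a12 a22 g x"
proof -
  have *: "partial i (partial j (\<lambda>x. f x - g x)) x
      = partial i (partial j f) x - partial i (partial j g) x" for i j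
  proof -
    have "partial i (partial j (\<lambda>x. f x - g x)) x = partial i (\<lambda>x. partial j f x - partial j g x) x"
      by (rule partial_cong[OF S]) (use f g in \<open>auto simp: partial_diff C2_onD\<close>)
    then show ?thesis using S f g by (simp add: partial_diff C2_onD)
  qed
  show ?thesis
    unfolding grushin_op_eq[OF S f] grushin_op_eq[OF S g] grushin_op_eq[OF S C2_on_diff[OF S(1) f g]] *
    by (simp add: algebra_simps)
qed

lemma grushin_op_const: "grushin_op a11 a12 a22 (\<lambda>x. c) x = 0"
  by (subst grushin_op_eq[where S=UNIV]) (auto simp: C2_on_const partial_const)

lemma grushin_op_square_fst: "grushin_op a11 a12 a22 (\<lambda>x. c * (x$1)\<^sup>2) x = 2 * c * a11 x"
  by (subst grushin_op_eq[where S=UNIV])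
    (auto simp: C2_on_square_fst partial_square_fst partial_scaled_fst partial_const)

lemma elliptic_coefficients:
  assumes "ellipticity_constants a11 a12 a22 lam Lam"
  shows "a11 x > 0" "(a12 x)\<^sup>2 \<le> a11 x * a22 x"
proof -
  have lam: "lam > 0" and
    form: "lam * (s\<^sup>2 + t\<^sup>2) \<le> a11 x * s\<^sup>2 + 2 * a12 x * s * t + a22 x * t\<^sup>2" for s t
  proof -
    show "lam > 0" using assms unfolding ellipticity_constants_def by blast
    have "lam * (((vector [s,t] :: real^2)$1)\<^sup>2 + ((vector [s,t] :: real^2)$2)\<^sup>2)
      \<le> a11 x * ((vector [s,t] :: real^2)$1)\<^sup>2
        + 2 * a12 x * (vector [s,t] :: real^2)$1 * (vector [s,t] :: real^2)$2
        + a22 x * ((vector [s,t] :: real^2)$2)\<^sup>2"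
      using assms unfolding ellipticity_constants_def by blast
    then show "lam * (s\<^sup>2 + t\<^sup>2) \<le> a11 x * s\<^sup>2 + 2 * a12 x * s * t + a22 x * t\<^sup>2"
      by simp
  qed
  show pos: "a11 x > 0" using form[of 1 0] lam by simp
  \<comment> \<open>The vector \<open>(- a12, a11)\<close> turns the quadratic form into
    \<open>a11\<close> times the determinant; dividing by \<open>a11 > 0\<close> leaves the
    determinant.\<close>
  have "0 \<le> lam * ((- a12 x)\<^sup>2 + (a11 x)\<^sup>2)" using lam by simp
  also have "\<dots> \<le> a11 x * (a11 x * a22 x - (a12 x)\<^sup>2)"
    using form[of "- a12 x" "a11 x"] by (simp add: power2_eq_square algebra_simps)
  finally show "(a12 x)\<^sup>2 \<le> a11 x * a22 x"
    using pos by (simp add: zero_le_mult_iff)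
qed

lemma grushin_op_nonpos_at_max:
  assumes ell: "ellipticity_constants a11 a12 a22 lam Lam"
    and S: "open S" "x \<in> S" and f: "C2_on S f" and max: "\<And>y. y \<in> S \<Longrightarrow> f y \<le> f x"
  shows "grushin_op a11 a12 a22 f x \<le> 0"
proof -
  note c = elliptic_coefficients[OF ell, of x]
  let ?A = "partial 1 (partial 1 f) x" and ?B = "partial 2 (partial 1 f) x"
    and ?C = "partial 2 (partial 2 f) x"
  \<comment> \<open>Completing the square: \<open>a\<^sub>1\<^sub>1 L f\<close> is the Hessian form at \<open>(a\<^sub>1\<^sub>1, a\<^sub>1\<^sub>2 x\<^sub>1)\<close>
    plus \<open>det A\<close> times the Hessian form at \<open>(0, x\<^sub>1)\<close>.\<close>
  have h1: "?A * (a11 x)\<^sup>2 + 2 * ?B * a11 x * (a12 x * x$1) + ?C * (a12 x * x$1)\<^sup>2 \<le> 0"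
    by (rule second_partials_nonpos_at_max[OF S f max])
  have "?C * (x$1)\<^sup>2 \<le> 0"
    using second_partials_nonpos_at_max[OF S f max, of 0 "x$1"] by simp
  then have h2: "(a11 x * a22 x - (a12 x)\<^sup>2) * (?C * (x$1)\<^sup>2) \<le> 0"
    using c(2) by (simp add: mult_nonneg_nonpos)
  have "a11 x * grushin_op a11 a12 a22 f x
      = (?A * (a11 x)\<^sup>2 + 2 * ?B * a11 x * (a12 x * x$1) + ?C * (a12 x * x$1)\<^sup>2)
        + (a11 x * a22 x - (a12 x)\<^sup>2) * (?C * (x$1)\<^sup>2)"
    unfolding grushin_op_eq[OF S f] by (simp add: power2_eq_square algebra_simps)
  also have "\<dots> \<le> 0" using h1 h2 by linarith
  finally show ?thesis using c(1) by (simp add: mult_le_0_iff)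
qed

text \<open>The perturbed difference \<open>v\<close> still has its maximum inside \<open>S\<close>
  if \<open>f > g\<close> somewhere. There \<open>L v\<close> is at most 0 by the maximum and
  positive by the perturbation.\<close>

lemma comparison_principle:
  assumes ell: "ellipticity_constants a11 a12 a22 lam Lam"
    and S: "open S" "bounded S"
    and f: "C2_on S f" "continuous_on (closure S) f"
    and g: "C2_on S g" "continuous_on (closure S) g"
    and L: "\<And>x. x \<in> S \<Longrightarrow> grushin_op a11 a12 a22 g x \<le> grushin_op a11 a12 a22 f x"
    and bd: "\<And>x. x \<in> frontier S \<Longrightarrow> f x \<le> g x"
    and x: "x \<in> S"
  shows "f x \<le> g x"
proof (rule ccontr)
  assume "\<not> f x \<le> g x"
  then have m: "f x - g x > 0" by simp
  have "bounded (closure S)" using S(2) by (rule bounded_closure)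
  then obtain B where B: "B > 0" "\<And>y. y \<in> closure S \<Longrightarrow> norm y \<le> B"
    using bounded_pos by blast
  have B2: "(y$1)\<^sup>2 \<le> B\<^sup>2" if "y \<in> closure S" for y
    using B(2)[OF that] component_le_norm_cart[of y 1] B(1)
    by (metis abs_le_square_iff abs_of_pos order_trans)
  \<comment> \<open>With this choice the perturbation is at most half the gap
    \<open>f x - g x\<close> on all of \<open>closure S\<close>.\<close>
  define \<epsilon> where "\<epsilon> = (f x - g x) / (2 * B\<^sup>2)"
  have \<epsilon>: "\<epsilon> > 0" "\<epsilon> * B\<^sup>2 < f x - g x" using m B by (auto simp: \<epsilon>_def)
  \<comment> \<open>Subtracting a negative multiple, rather than adding, lets the rules for
    differences apply.\<close>
  define v where "v y = f y - g y - (- \<epsilon>) * (y$1)\<^sup>2" for y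
  have "continuous_on (closure S) v"
    unfolding v_def using f g by (intro continuous_intros) auto
  moreover have "compact (closure S)" "closure S \<noteq> {}" using S x by auto
  ultimately obtain z where z: "z \<in> closure S" "\<And>y. y \<in> closure S \<Longrightarrow> v y \<le> v z"
    using continuous_attains_sup by metis
  have "x \<in> closure S" using x closure_subset by blast
  then have "f x - g x \<le> v z"
    using z(2)[of x] \<epsilon> by (simp add: v_def) (smt (verit) mult_nonneg_nonneg zero_le_power2)
  \<comment> \<open>The value \<open>v z\<close> is at least the gap at \<open>x\<close>, of which
    the perturbation supplies less than all; hence \<open>f z > g z\<close> and \<open>z\<close> is
    not on the frontier.\<close>
  moreover have "\<epsilon> * (z$1)\<^sup>2 \<le> \<epsilon> * B\<^sup>2" using B2[OF z(1)] \<epsilon> by simp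
  ultimately have "f z > g z" using \<epsilon>(2) by (simp add: v_def)
  with bd have "z \<notin> frontier S" by force
  with z(1) have zS: "z \<in> S" using S by (simp add: frontier_def interior_open)
  have d: "C2_on S (\<lambda>y. f y - g y)" using S f g C2_on_diff by blast
  have "grushin_op a11 a12 a22 v z \<le> 0"
  proof (rule grushin_op_nonpos_at_max[OF ell S(1) zS])
    show "C2_on S v" unfolding v_def by (intro C2_on_diff S d C2_on_square_fst)
    show "v y \<le> v z" if "y \<in> S" for y using z(2)[of y] that closure_subset by blast
  qed
  moreover have "grushin_op a11 a12 a22 v z
      = grushin_op a11 a12 a22 f z - grushin_op a11 a12 a22 g z + 2 * \<epsilon> * a11 z"
    unfolding v_def grushin_op_diff[OF S(1) zS d C2_on_square_fst]
      grushin_op_diff[OF S(1) zS f(1) g(1)] grushin_op_square_fst by simp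
  moreover have "2 * \<epsilon> * a11 z > 0" using \<epsilon>(1) elliptic_coefficients(1)[OF ell] by simp
  ultimately show False using L[OF zS] by linarith
qed

section \<open>The sets \<open>G_tilde y r\<close>\<close>

text \<open>The fourth power of \<open>rho\<close>, free of the root; the centre comes first so that
  \<open>rho4 y\<close> is a function of the point.\<close>

definition rho4 :: "real^2 \<Rightarrow> real^2 \<Rightarrow> real" where
  "rho4 y x = ((x$1)\<^sup>2 - (y$1)\<^sup>2)\<^sup>2 + 4 * (x$2 - y$2)\<^sup>2"

text \<open>One formula for both branches of \<open>g_tilde\<close>: \<open>r^4\<close> if
  \<open>\<bar>y$1\<bar> < r\<close>, and \<open>r^2 * (y$1)^2\<close> otherwise.\<close>

definition G_level :: "real^2 \<Rightarrow> real \<Rightarrow> real" where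
  "G_level y r = (r * max r \<bar>y$1\<bar>)\<^sup>2"

text \<open>Either branch of \<open>g_tilde\<close> says that \<open>rho\<close> squared is below
  \<open>r * max r \<bar>y$1\<bar>\<close>; squaring once more preserves the inequality, both sides
  being nonnegative.\<close>

lemma G_tilde_eq:
  assumes r: "r > 0"
  shows "G_tilde y r = {x. rho4 y x < G_level y r}"
proof -
  have "g_tilde r x y < r \<longleftrightarrow> rho4 y x < G_level y r" for x
  proof -
    have nn: "rho4 y x \<ge> 0" by (simp add: rho4_def)
    have rho: "rho x y = root 4 (rho4 y x)" by (simp add: rho_def rho4_def)
    have pos: "rho x y \<ge> 0" using nn by (simp add: rho)
    have p4: "rho4 y x = ((rho x y)\<^sup>2)\<^sup>2" using nn by (simp add: rho real_root_pow_pos2)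
    have mx: "r * max r \<bar>y$1\<bar> > 0" using r by (simp add: less_max_iff_disj)
    have sq_less: "a < b \<longleftrightarrow> a\<^sup>2 < b\<^sup>2" if "0 \<le> a" "0 \<le> b" for a b :: real
      using that power_mono_iff[of b a 2] by (simp flip: not_le)
    have "g_tilde r x y < r \<longleftrightarrow> (rho x y)\<^sup>2 < r * max r \<bar>y$1\<bar>"
    proof (cases "\<bar>y$1\<bar> < r")
      case True
      have "rho x y < r \<longleftrightarrow> (rho x y)\<^sup>2 < r\<^sup>2"
        using pos r by (intro sq_less) auto
      with True show ?thesis by (simp add: g_tilde_def max_def power2_eq_square)
    next
      case False
      then show ?thesis using r by (simp add: g_tilde_def max_def divide_less_eq)
    qed
    also have "\<dots> \<longleftrightarrow> rho4 y x < G_level y r"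
      unfolding p4 G_level_def using mx by (intro sq_less) auto
    finally show ?thesis .
  qed
  then show ?thesis by (simp add: G_tilde_def)
qed

lemma G_level_strict_mono:
  assumes "0 < r" "r < s"
  shows "G_level y r < G_level y s"
proof -
  \<comment> \<open>The maximum may stay constant at \<open>\<bar>y$1\<bar>\<close>; strictness
    comes from the factor \<open>r\<close>.\<close>
  have "r * max r \<bar>y$1\<bar> < s * max s \<bar>y$1\<bar>"
    using assms by (intro mult_less_le_imp_less) (auto simp: less_max_iff_disj)
  then show ?thesis
    unfolding G_level_def using assms by (intro power_strict_mono) (auto simp: max_def)
qed

lemma continuous_on_rho4: "continuous_on A (rho4 y)"
  unfolding rho4_def[abs_def] by (intro continuous_intros)

lemma open_G_tilde: "r > 0 \<Longrightarrow> open (G_tilde y r)"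
  by (simp add: G_tilde_eq open_Collect_less continuous_on_rho4)

lemma closure_G_tilde:
  assumes "r > 0" "x \<in> closure (G_tilde y r)"
  shows "rho4 y x \<le> G_level y r"
  using continuous_le_on_closure[OF continuous_on_rho4 assms(2)] assms(1)
  by (simp add: G_tilde_eq)

text \<open>Closure points satisfy the weak inequality, and openness excludes the strict
  one.\<close>

lemma frontier_G_tilde:
  assumes "r > 0" "x \<in> frontier (G_tilde y r)"
  shows "rho4 y x = G_level y r"
  using assms closure_G_tilde[of r x y] open_G_tilde[of r y]
  by (simp add: frontier_def interior_open) (simp add: G_tilde_eq)

lemma closure_G_tilde_subset:
  assumes "0 < r" "r < s"
  shows "closure (G_tilde y r) \<subseteq> G_tilde y s"
  using assms closure_G_tilde G_level_strict_mono[OF assms, of y]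
  by (fastforce simp: G_tilde_eq)

lemma frontier_G_tilde_subset_ring3:
  assumes "r > 0"
  shows "frontier (G_tilde y (2 * r)) \<subseteq> ring3 y r"
  using frontier_G_tilde[of "2 * r" _ y] closure_G_tilde[of r _ y]
    G_level_strict_mono[of r "2 * r" y] G_level_strict_mono[of "2 * r" "3 * r" y] assms
  by (fastforce simp: ring3_def G_tilde_eq)

lemma bounded_G_tilde:
  assumes "r > 0"
  shows "bounded (G_tilde y r)"
proof -
  define c where "c = G_level y r"
  have "norm x \<le> (\<bar>(y$1)\<^sup>2\<bar> + c + 2) + (\<bar>y$2\<bar> + c + 1)" if "x \<in> G_tilde y r" for x
  proof -
    have le: "((x$1)\<^sup>2 - (y$1)\<^sup>2)\<^sup>2 + 4 * (x$2 - y$2)\<^sup>2 < c"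
      using that assms by (simp add: G_tilde_eq rho4_def c_def)
    have sq: "\<bar>t\<bar> \<le> t\<^sup>2 + 1" for t :: real
    proof -
      have "0 \<le> (\<bar>t\<bar> - 1)\<^sup>2" by simp
      then have "2 * \<bar>t\<bar> \<le> t\<^sup>2 + 1" by (simp add: power2_eq_square algebra_simps)
      then show ?thesis by simp
    qed
    \<comment> \<open>The elementary bound removes squares one at a time: \<open>rho4\<close>
      controls the difference of squares, which controls the square of \<open>x$1\<close>, which
      controls \<open>x$1\<close>.\<close>
    have "\<bar>x$1\<bar> \<le> (x$1)\<^sup>2 + 1" "\<bar>(x$1)\<^sup>2 - (y$1)\<^sup>2\<bar> \<le> ((x$1)\<^sup>2 - (y$1)\<^sup>2)\<^sup>2 + 1"
      "\<bar>x$2 - y$2\<bar> \<le> (x$2 - y$2)\<^sup>2 + 1" by (intro sq)+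
    moreover have "((x$1)\<^sup>2 - (y$1)\<^sup>2)\<^sup>2 \<ge> 0" "(x$2 - y$2)\<^sup>2 \<ge> 0" by simp_all
    ultimately have "\<bar>x$1\<bar> \<le> \<bar>(y$1)\<^sup>2\<bar> + c + 2" "\<bar>x$2\<bar> \<le> \<bar>y$2\<bar> + c + 1"
      using le by linarith+
    moreover have "norm x \<le> \<bar>x$1\<bar> + \<bar>x$2\<bar>"
      using norm_le_l1_cart[of x] by (simp add: sum_2)
    ultimately show ?thesis by linarith
  qed
  then show ?thesis by (auto simp: bounded_iff)
qed

section \<open>From barriers to the double ball property\<close>

theorem theorem6p2:
  fixes a11 a12 a22 :: "real^2 \<Rightarrow> real" and lam Lam \<gamma> :: real
  assumes "a11 \<in> borel_measurable lebesgue"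
    and "a12 \<in> borel_measurable lebesgue"
    and "a22 \<in> borel_measurable lebesgue"
    and "ellipticity_constants a11 a12 a22 lam Lam"
    and "0 < \<gamma>" and "\<gamma> < 1"
    and "\<And>y r. r > 0 \<Longrightarrow> \<exists>\<Phi>. lower_barrier (grushin_op a11 a12 a22) \<gamma> y r \<Phi>"
  shows "double_ball_property (grushin_op a11 a12 a22) \<gamma>"
  unfolding double_ball_property_def
proof (intro allI impI ballI)
  fix y r u x
  assume r: "(r::real) > 0"
    and u: "C2_on (G_tilde y (3 * r)) u" "continuous_on (closure (G_tilde y (3 * r))) u"
    and u0: "\<forall>x\<in>G_tilde y (3 * r). u x \<ge> 0"
    and Lu: "\<forall>x\<in>G_tilde y (3 * r). grushin_op a11 a12 a22 u x \<le> 0"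
    and u1: "\<forall>x\<in>G_tilde y r. u x \<ge> 1"
    and x: "x \<in> G_tilde y (2 * r)"
  note ell = assms(4)
  let ?G = "G_tilde y" and ?R = "ring3 y r"
  obtain \<Phi> where "lower_barrier (grushin_op a11 a12 a22) \<gamma> y r \<Phi>" using assms(7) r by blast
  then have \<Phi>: "C2_on ?R \<Phi>" "continuous_on (closure ?R) \<Phi>"
    and L\<Phi>: "\<And>z. z \<in> ?R \<Longrightarrow> grushin_op a11 a12 a22 \<Phi> z \<ge> 0"
    and \<Phi>0: "\<And>z. z \<in> frontier (?G (3 * r)) \<Longrightarrow> \<Phi> z \<le> 0"
    and \<Phi>1: "\<And>z. z \<in> frontier (?G r) \<Longrightarrow> \<Phi> z \<le> 1"
    and \<Phi>\<gamma>: "(INF z\<in>frontier (?G (2 * r)). \<Phi> z) \<ge> \<gamma>"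
    unfolding lower_barrier_def by blast+
  have RG: "?R \<subseteq> ?G (3 * r)" by (auto simp: ring3_def)
  have cl2: "closure (?G (2 * r)) \<subseteq> ?G (3 * r)" and cl1: "closure (?G r) \<subseteq> ?G (3 * r)"
    using r by (simp_all add: closure_G_tilde_subset)
  have ring: "\<Phi> z \<le> u z" if "z \<in> ?R" for z
  proof (rule comparison_principle[OF ell _ _ \<Phi> _ _ _ _ that])
    show "open ?R" unfolding ring3_def using r by (intro open_Diff open_G_tilde) auto
    show "bounded ?R" using bounded_subset[OF bounded_G_tilde RG] r by simp
    show "C2_on ?R u" using u(1) RG by (rule C2_on_subset)
    show "continuous_on (closure ?R) u" using u(2) closure_mono[OF RG] continuous_on_subset by blast
    show "grushin_op a11 a12 a22 u z \<le> grushin_op a11 a12 a22 \<Phi> z" if "z \<in> ?R" for z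
      using L\<Phi>[OF that] Lu RG that by (meson order_trans subsetD)
    show "\<Phi> z \<le> u z" if z: "z \<in> frontier ?R" for z
    proof -
      \<comment> \<open>The ring is the outer ball intersected with the complement of a closed set,
        so its frontier splits between the two spheres.\<close>
      have "frontier ?R \<subseteq> frontier (?G (3 * r)) \<union> frontier (closure (?G r))"
        using frontier_Int_subset[of "?G (3 * r)" "- closure (?G r)"]
        by (simp only: ring3_def Diff_eq frontier_complement)
      moreover have "frontier (closure (?G r)) \<subseteq> frontier (?G r)"
        using interior_mono[OF closure_subset] by (auto simp: frontier_def)
      ultimately consider "z \<in> frontier (?G (3 * r))" | "z \<in> frontier (?G r)" using z by blast
      then show ?thesis
      proof cases
        case 1
        then have "z \<in> closure (?G (3 * r))" by (simp add: frontier_def)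
        \<comment> \<open>The bound \<open>u \<ge> 0\<close> is assumed only on the open ball;
          continuity carries it to the outer sphere, and likewise \<open>u \<ge> 1\<close> to the
          inner one below.\<close>
        from continuous_ge_on_closure[OF u(2) this, of 0] \<Phi>0[OF 1] u0 show ?thesis by fastforce
      next
        case 2
        then have "z \<in> closure (?G r)" by (simp add: frontier_def)
        moreover have "continuous_on (closure (?G r)) u"
          using u(2) cl1 closure_subset continuous_on_subset by (metis order_trans)
        ultimately have "u z \<ge> 1" using continuous_ge_on_closure[of "?G r" u z 1] u1 by blast
        with \<Phi>1[OF 2] show ?thesis by simp
      qed
    qed
  qed
  have mid: "frontier (?G (2 * r)) \<subseteq> ?R" using r by (rule frontier_G_tilde_subset_ring3)
  have "continuous_on (frontier (?G (2 * r))) \<Phi>"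
    using \<Phi>(2) mid closure_subset continuous_on_subset by (metis order_trans)
  moreover have "compact (frontier (?G (2 * r)))"
    using r by (intro compact_frontier_bounded bounded_G_tilde) simp
  ultimately have "bdd_below (\<Phi> ` frontier (?G (2 * r)))"
    by (intro bounded_imp_bdd_below compact_imp_bounded compact_continuous_image)
  then have u\<gamma>: "\<gamma> \<le> u z" if "z \<in> frontier (?G (2 * r))" for z
    using cINF_lower[OF _ that] \<Phi>\<gamma> ring mid that by (meson order_trans subsetD)
  have G2: "?G (2 * r) \<subseteq> ?G (3 * r)" using cl2 closure_subset by (rule order_trans[rotated])
  show "u x \<ge> \<gamma>"
  \<comment> \<open>Here the constant \<open>\<gamma>\<close> is the lower function, with
    \<open>L \<gamma> = 0\<close>, and \<open>u\<gamma>\<close> supplies the frontier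
    condition.\<close>
  proof (rule comparison_principle[OF ell _ _ C2_on_const continuous_on_const _ _ _ u\<gamma> x])
    show "open (?G (2 * r))" "bounded (?G (2 * r))"
      using r by (auto intro: open_G_tilde bounded_G_tilde)
    show "C2_on (?G (2 * r)) u" using u(1) G2 by (rule C2_on_subset)
    show "continuous_on (closure (?G (2 * r))) u"
      using u(2) closure_mono[OF G2] continuous_on_subset by blast
    show "grushin_op a11 a12 a22 u z \<le> grushin_op a11 a12 a22 (\<lambda>x. \<gamma>) z" if "z \<in> ?G (2 * r)" for z
      using Lu G2 that by (auto simp: grushin_op_const)
  qed
qed

end
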